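(* Let $n \geq 1$ be an integer and let $\varepsilon > 0$ be given. Then the set $$\{\mu^F(P) \mid P \in \mathcal{S}^F(n,\varepsilon)\}$$ is finite, where $\mathcal{S}^F(n,\varepsilon)$ is the set of all $n$-dimensional lattice polytopes $P\subseteq\mathbb{R}^n$ with $\mu^F(P)\ge\varepsilon$.
   Context: A lattice polytope in $\mathbb{R}^n$ is the convex hull of finitely many points of $\mathbb{Z}^n$. Fine adjoint polytope: for an $n$-dimensional rational polytope $P\subseteq\mathbb{R}^n$ and $\alpha \in (\mathbb{R}^n)^*$ put $d_P^F(\alpha) := \min_{x\in P}\langle \alpha, x\rangle$. For real $s>0$ let $$P^{F(s)} := \{x\in\mathbb{R}^n \mid \langle a,x\rangle \ge d_P^F(a)+s \text{ for all } a\in(\mathbb{Z}^n)^*\setminus\{0\}\}.$$ Fine $\mathbb{Q}$-codegree: $\mu^F(P) := \left(\sup\{s>0 \mid P^{F(s)}\neq\emptyset\}\right)^{-1}$. *)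

theory Defs
  imports "HOL-Analysis.Analysis"
begin

definition int_lattice :: "(real ^ 'n) set" where
  "int_lattice = {x. \<forall>i. x $ i \<in> \<int>}"

definition lattice_polytope :: "(real ^ 'n) set \<Rightarrow> bool" where
  "lattice_polytope P \<longleftrightarrow> (\<exists>V. finite V \<and> V \<subseteq> int_lattice \<and> P = convex hull V)"

text \<open>
  Linear functionals on \<open>real ^ 'n\<close> are represented by vectors through the inner product,
  so the dual lattice is again \<open>int_lattice\<close>. The minimum of a functional over a nonempty
  compact set is written as an infimum; it is attained by \<open>d_fine_attained\<close> below.
\<close>

definition d_fine :: "(real ^ 'n) set \<Rightarrow> real ^ 'n \<Rightarrow> real" where
  "d_fine P a = (INF x\<in>P. a \<bullet> x)"

definition fine_adjoint :: "(real ^ 'n) set \<Rightarrow> real \<Rightarrow> (real ^ 'n) set" where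
  "fine_adjoint P s = {x. \<forall>a \<in> int_lattice - {0}. a \<bullet> x \<ge> d_fine P a + s}"

text \<open>
  For a full-dimensional polytope the set of admissible \<open>s\<close> is nonempty and bounded above
  (lemmas \<open>fine_adjoint_witness\<close> and \<open>fine_adjoint_bdd_above\<close>), so the real supremum is
  the usual one and is positive.
\<close>

definition fine_codegree :: "(real ^ 'n) set \<Rightarrow> real" where
  "fine_codegree P = inverse (Sup {s. s > 0 \<and> fine_adjoint P s \<noteq> {}})"

lemma d_fine_attained:
  fixes P :: "(real ^ 'n) set"
  assumes "compact P" "P \<noteq> {}"
  shows "\<exists>x\<in>P. d_fine P a = a \<bullet> x \<and> (\<forall>y\<in>P. a \<bullet> x \<le> a \<bullet> y)"
proof -
  have "continuous_on P (\<lambda>x. a \<bullet> x)"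
    by (intro continuous_intros)
  then obtain x where x: "x \<in> P" "\<forall>y\<in>P. a \<bullet> x \<le> a \<bullet> y"
    using continuous_attains_inf[OF assms] by blast
  have "d_fine P a = a \<bullet> x"
    unfolding d_fine_def by (rule cInf_eq_minimum) (use x in auto)
  with x show ?thesis by blast
qed

lemma norm_int_lattice_ge_1:
  fixes a :: "real ^ 'n"
  assumes "a \<in> int_lattice - {0}"
  shows "norm a \<ge> 1"
proof -
  obtain i where i: "a $ i \<noteq> 0"
    using assms by (auto simp: vec_eq_iff)
  have "a $ i \<in> \<int>" using assms by (simp add: int_lattice_def)
  then have "\<bar>a $ i\<bar> \<ge> 1" using i by (rule Ints_nonzero_abs_ge1)
  with component_le_norm_cart[of a i] show ?thesis by linarith
qed

lemma fine_adjoint_witness: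
  fixes P :: "(real ^ 'n) set"
  assumes "compact P" "interior P \<noteq> {}"
  shows "\<exists>s>0. fine_adjoint P s \<noteq> {}"
proof -
  obtain x r where r: "r > 0" "cball x r \<subseteq> P"
    using assms(2) by (auto simp: mem_interior_cball)
  have "x \<in> fine_adjoint P r"
    unfolding fine_adjoint_def
  proof (intro CollectI ballI)
    fix a :: "real ^ 'n"
    assume a: "a \<in> int_lattice - {0}"
    note n = norm_int_lattice_ge_1[OF a]
    define y where "y = x - (r / norm a) *\<^sub>R a"
    have yP: "y \<in> P"
      using r n by (intro subsetD[OF r(2)]) (simp add: y_def dist_norm)
    have ay: "a \<bullet> y = a \<bullet> x - r * norm a"
      using n by (simp add: y_def inner_diff_right dot_square_norm power2_eq_square)
    have "d_fine P a \<le> a \<bullet> y"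
      using d_fine_attained[OF assms(1), of a] yP by force
    moreover have "r * norm a \<ge> r" using n r(1) by simp
    ultimately show "d_fine P a + r \<le> a \<bullet> x" using ay by linarith
  qed
  with r(1) show ?thesis by blast
qed

lemma fine_adjoint_bdd_above:
  fixes P :: "(real ^ 'n) set"
  shows "bdd_above {s. s > 0 \<and> fine_adjoint P s \<noteq> {}}"
proof -
  obtain i :: 'n where True by blast
  define a :: "real ^ 'n" where "a = axis i 1"
  have a: "a \<in> int_lattice - {0}" "- a \<in> int_lattice - {0}"
    by (auto simp: a_def int_lattice_def axis_def vec_eq_iff)
  show ?thesis
  proof (rule bdd_aboveI)
    fix s assume "s \<in> {s. s > 0 \<and> fine_adjoint P s \<noteq> {}}"
    then obtain x where x: "x \<in> fine_adjoint P s" by blast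
    have "a \<bullet> x \<ge> d_fine P a + s" "(- a) \<bullet> x \<ge> d_fine P (- a) + s"
      using x a by (auto simp only: fine_adjoint_def mem_Collect_eq)
    then show "s \<le> (- d_fine P a - d_fine P (- a)) / 2" by simp
  qed
qed

end

theory Submission
  imports Defs
begin

text \<open>
  Let \<open>s\<close> be the largest value with a nonempty Fine adjoint and \<open>x\<close> a point of that adjoint.
  By maximality the origin is a positive convex combination \<open>\<Sum> l\<^sub>i a\<^sub>i\<close> of affinely independent
  normals active at \<open>x\<close>, so that \<open>s = - \<Sum> l\<^sub>i d(a\<^sub>i)\<close> with integers \<open>d(a\<^sub>i)\<close>. The constraints
  for all other lattice normals force the origin to be the only lattice point in the relative
  interior of the simplex spanned by the \<open>a\<^sub>i\<close>. The barycentric coordinates of such a point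
  have denominators bounded in terms of the dimension (Hensley), so \<open>s\<close> has bounded
  denominator. As \<open>0 < s \<le> 1 / \<epsilon>\<close>, only finitely many values remain.
\<close>

section \<open>Barycentric weights of lattice simplices with one interior lattice point\<close>

text \<open>
  If \<open>l\<close> gives the barycentric coordinates of the origin in a lattice simplex, the vectors
  \<open>m l - n\<close> with coordinate sum 1 are the coordinates of the points of the lattice
  generated by the vertices.
\<close>

definition isolated_weights :: "'i set \<Rightarrow> ('i \<Rightarrow> real) \<Rightarrow> bool" where
  "isolated_weights I l \<longleftrightarrow> finite I \<and> (\<forall>i\<in>I. l i > 0) \<and> sum l I = 1 \<and>
     (\<forall>(m::int) (n::'i \<Rightarrow> int).
        (\<forall>i\<in>I. of_int m * l i - of_int (n i) > 0) \<and>
        (\<Sum>i\<in>I. of_int m * l i - of_int (n i)) = 1 \<longrightarrow>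
        (\<forall>i\<in>I. of_int m * l i - of_int (n i) = l i))"

lemma isolated_weightsD:
  assumes "isolated_weights I l"
  shows "finite I" "\<And>i. i \<in> I \<Longrightarrow> l i > 0" "sum l I = 1"
    "\<And>(m::int) n i. \<lbrakk>\<And>i. i \<in> I \<Longrightarrow> of_int m * l i - of_int (n i) > 0;
        (\<Sum>i\<in>I. of_int m * l i - of_int (n i)) = 1; i \<in> I\<rbrakk> \<Longrightarrow> of_int m * l i - of_int (n i) = l i"
  using assms unfolding isolated_weights_def by blast+

text \<open>Simultaneous Dirichlet approximation, transported along an enumeration of
  \<open>J\<close>. The bound \<open>N ^ k\<close> is uniform over all index sets of at most
  \<open>k\<close> elements.\<close>

lemma Dirichlet_approx_finite_set:
  fixes f :: "'i \<Rightarrow> real"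
  assumes "N > 0" "finite J" "card J \<le> k"
  obtains q p where "0 < q" "q \<le> int (N ^ k)"
    "\<And>i. i \<in> J \<Longrightarrow> \<bar>of_int q * f i - of_int (p i)\<bar> < 1 / N"
proof -
  obtain h where h: "bij_betw h {0..<card J} J"
    using ex_bij_betw_nat_finite[OF assms(2)] by blast
  obtain q p where q: "0 < q" "q \<le> int (N ^ card J)"
    and p: "\<And>i. i < card J \<Longrightarrow> \<bar>of_int q * f (h i) - of_int (p i)\<bar> < 1 / N"
    by (rule Dirichlet_approx_simult[OF assms(1), where n = "card J" and \<theta> = "f \<circ> h"]) auto
  have "N ^ card J \<le> N ^ k"
    using assms by (intro power_increasing) auto
  with q(2) have "q \<le> int (N ^ k)" by linarith
  moreover have "\<bar>of_int q * f i - of_int (p (inv_into {0..<card J} h i))\<bar> < 1 / N" if "i \<in> J" for i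
  proof -
    have "inv_into {0..<card J} h i < card J" "h (inv_into {0..<card J} h i) = i"
      using h that by (auto simp: bij_betw_def intro: f_inv_into_f)
        (metis atLeastLessThan_iff inv_into_into)
    with p show ?thesis by metis
  qed
  ultimately show thesis
    using q(1) that[of q "\<lambda>i. p (inv_into {0..<card J} h i)"] by blast
qed

text \<open>
  Hensley's argument: if \<open>q l\<close> is nearly integral on the large coordinates while the others
  are tiny, then subtracting the nearest integers from \<open>(1 + q) l\<close> gives another interior
  point, so there are no tiny coordinates and \<open>q l\<close> is integral.
\<close>

lemma isolated_weights_gap:
  fixes \<delta> :: real
  assumes "\<delta> > 0"
  obtains Q :: nat and \<delta>' :: real where "\<delta>' > 0"
    "\<And>(I :: 'i set) l J. \<lbrakk>isolated_weights I l; card I \<le> k; J \<subseteq> I; \<And>i. i \<in> J \<Longrightarrow> l i \<ge> \<delta>;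
       \<And>i. i \<in> I - J \<Longrightarrow> l i < \<delta>'\<rbrakk> \<Longrightarrow> J = I \<and> (\<exists>q\<in>{1..Q}. \<forall>i\<in>I. of_nat q * l i \<in> \<int>)"
proof -
  \<comment> \<open>Errors below \<open>\<delta>\<close> keep the perturbed large coordinates
    positive; errors below \<open>1 / (k + 1)\<close> add up to less than 1 over at most
    \<open>k\<close> indices.\<close>
  obtain N :: nat where N: "N > 0" "1 / N < min \<delta> (1 / (real k + 1))"
    using assms by (metis add.commute divide_pos_pos min_less_iff_conj nat_approx_posE
        of_nat_0_less_iff of_nat_Suc zero_less_Suc zero_less_one)
  define Q where "Q = N ^ k"
  \<comment> \<open>Chosen so that \<open>q * l i\<close> with \<open>q \<le> Q\<close> stays below
    \<open>1 / N\<close> on the small coordinates.\<close>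
  define \<delta>' where "\<delta>' = 1 / (real N * real Q)"
  have Q: "Q > 0" using N by (simp add: Q_def)
  have "\<delta>' > 0" using N Q by (simp add: \<delta>'_def)
  moreover have "J = I \<and> (\<exists>q\<in>{1..Q}. \<forall>i\<in>I. of_nat q * l i \<in> \<int>)"
    if iso: "isolated_weights I l" and card: "card I \<le> k" and JI: "J \<subseteq> I"
      and large: "\<And>i. i \<in> J \<Longrightarrow> l i \<ge> \<delta>" and small: "\<And>i. i \<in> I - J \<Longrightarrow> l i < \<delta>'"
    for I :: "'i set" and l J
  proof -
    note I = isolated_weightsD[OF iso]
    have J: "finite J" "card J \<le> k"
      using JI I(1) card card_mono[of I J] finite_subset by auto
    obtain q p where q: "0 < q" "q \<le> int (N ^ k)"
      and p: "\<And>i. i \<in> J \<Longrightarrow> \<bar>of_int q * l i - of_int (p i)\<bar> < 1 / N"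
      using Dirichlet_approx_finite_set[OF N(1) J, of l] by metis
    \<comment> \<open>Rounding down to 0 off \<open>J\<close> leaves
      \<open>e i = q * l i > 0\<close> there, so only the coordinates in \<open>J\<close> could lose
      positivity.\<close>
    define n where "n = (\<lambda>i. if i \<in> J then p i else 0)"
    define e where "e = (\<lambda>i. of_int q * l i - of_int (n i))"
    have e: "\<bar>e i\<bar> < 1 / N" if "i \<in> I" for i
    proof (cases "i \<in> J")
      case True
      then show ?thesis using p by (simp add: e_def n_def)
    next
      case False
      have "real_of_int q \<le> real Q"
        using q unfolding Q_def by linarith
      have "of_int q * l i \<le> real Q * l i"
        using \<open>real_of_int q \<le> real Q\<close> I(2)[OF that] by (intro mult_right_mono) auto
      also have "\<dots> < real Q * \<delta>'"
        using small[of i] False that Q by (intro mult_strict_left_mono) auto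
      also have "\<dots> = 1 / N" using Q by (simp add: \<delta>'_def)
      finally show ?thesis using False q I(2)[OF that] by (simp add: e_def n_def)
    qed
    have epos: "l i + e i > 0" if "i \<in> I" for i
    proof (cases "i \<in> J")
      case True
      then show ?thesis using large[of i] e[OF that] N(2) by linarith
    next
      case False
      then show ?thesis using I(2)[OF that] q by (simp add: e_def n_def add_pos_pos)
    qed
    \<comment> \<open>Since \<open>l\<close> sums to 1, the total error is an integer; being less
      than 1 in absolute value, it vanishes. Hence \<open>l + e\<close> again has coordinate sum 1
      and isolation applies to it with \<open>m = 1 + q\<close>.\<close>
    have "sum e I = of_int q * sum l I - of_int (\<Sum>i\<in>I. n i)"
      by (simp add: e_def sum_subtractf sum_distrib_left)
    then have se: "sum e I = of_int (q - (\<Sum>i\<in>I. n i))"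
      using I(3) by simp
    have "\<bar>sum e I\<bar> \<le> (\<Sum>i\<in>I. \<bar>e i\<bar>)" by (rule sum_abs)
    also have "\<dots> \<le> (\<Sum>i\<in>I. 1 / N)" by (intro sum_mono) (use e in force)
    also have "\<dots> = real (card I) * (1 / N)" by simp
    also have "\<dots> \<le> real k * (1 / N)"
      using card by (intro mult_right_mono) auto
    also have "\<dots> \<le> real k * (1 / (real k + 1))"
      using N by (intro mult_left_mono) auto
    also have "\<dots> < 1" by simp
    finally have "\<bar>real_of_int (q - (\<Sum>i\<in>I. n i))\<bar> < 1" unfolding se .
    then have "\<bar>q - (\<Sum>i\<in>I. n i)\<bar> < 1"
      by (simp only: of_int_abs[symmetric] of_int_less_1_iff)
    then have "sum e I = 0" unfolding se by simp
    moreover have eq: "of_int (1 + q) * l i - of_int (n i) = l i + e i" for i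
      by (simp add: e_def algebra_simps)
    ultimately have "l i + e i = l i" if "i \<in> I" for i
      using I(4)[of "1 + q" n i] epos that I(3) by (simp only: eq sum.distrib)
    then have e0: "of_int q * l i = of_int (n i)" if "i \<in> I" for i
      using that by (simp add: e_def)
    have "i \<in> J" if "i \<in> I" for i
      using e0[OF that] I(2)[OF that] q by (auto simp: n_def split: if_splits)
    moreover have "of_nat (nat q) * l i \<in> \<int>" if "i \<in> I" for i
      using e0[OF that] q by simp
    moreover have "nat q \<in> {1..Q}" using q by (auto simp: Q_def nat_le_iff)
    ultimately show ?thesis using JI by blast
  qed
  ultimately show thesis by (rule that)
qed

text \<open>Induction on \<open>j\<close>: if the coordinates that are at least
  \<open>\<delta>\<close> do not exhaust \<open>I\<close>, the gap lemma forbids all the others from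
  lying below \<open>\<delta>'\<close>. Lowering the threshold to
  \<open>min \<delta> \<delta>'\<close> therefore captures at least one more.\<close>

lemma isolated_weights_many_large:
  "\<exists>\<delta>>0. \<forall>(I :: 'i set) l. isolated_weights I l \<and> card I \<le> k \<longrightarrow>
     (\<forall>i\<in>I. l i \<ge> \<delta>) \<or> j \<le> card {i\<in>I. l i \<ge> \<delta>}"
proof (induction j)
  case 0
  show ?case by (intro exI[of _ 1]) auto
next
  case (Suc j)
  then obtain \<delta> :: real where \<delta>: "\<delta> > 0"
    "\<And>(I :: 'i set) l. \<lbrakk>isolated_weights I l; card I \<le> k\<rbrakk> \<Longrightarrow>
       (\<forall>i\<in>I. l i \<ge> \<delta>) \<or> j \<le> card {i\<in>I. l i \<ge> \<delta>}"
    by blast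
  obtain Q :: nat and \<delta>' :: real where \<delta>': "\<delta>' > 0"
    "\<And>(I :: 'i set) l J. \<lbrakk>isolated_weights I l; card I \<le> k; J \<subseteq> I; \<And>i. i \<in> J \<Longrightarrow> l i \<ge> \<delta>;
       \<And>i. i \<in> I - J \<Longrightarrow> l i < \<delta>'\<rbrakk> \<Longrightarrow> J = I \<and> (\<exists>q\<in>{1..Q}. \<forall>i\<in>I. of_nat q * l i \<in> \<int>)"
    by (rule isolated_weights_gap[OF \<delta>(1)]) blast
  show ?case
  proof (intro exI[of _ "min \<delta> \<delta>'"] conjI allI impI)
    show "min \<delta> \<delta>' > 0" using \<delta> \<delta>' by simp
    fix I :: "'i set" and l
    assume I: "isolated_weights I l \<and> card I \<le> k"
    define J where "J = {i\<in>I. l i \<ge> \<delta>}"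
    have fin: "finite I" using I isolated_weightsD by blast
    show "(\<forall>i\<in>I. l i \<ge> min \<delta> \<delta>') \<or> Suc j \<le> card {i\<in>I. l i \<ge> min \<delta> \<delta>'}"
    proof (cases "J = I")
      case True
      then show ?thesis by (auto simp: J_def min_le_iff_disj)
    next
      case False
      have J: "J \<subseteq> I" "\<And>i. i \<in> J \<Longrightarrow> l i \<ge> \<delta>" by (simp_all add: J_def)
      have "\<not> (\<forall>i\<in>I - J. l i < \<delta>')"
      proof
        assume "\<forall>i\<in>I - J. l i < \<delta>'"
        then have "\<And>i. i \<in> I - J \<Longrightarrow> l i < \<delta>'" by (rule bspec)
        from \<delta>'(2)[OF conjunct1[OF I] conjunct2[OF I] J this] False show False by simp
      qed
      then obtain i where i: "i \<in> I - J" "l i \<ge> \<delta>'" by (auto simp: not_less)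
      have "\<not> (\<forall>i\<in>I. l i \<ge> \<delta>)" using False unfolding J_def by blast
      then have "j \<le> card J"
        using \<delta>(2)[OF conjunct1[OF I] conjunct2[OF I]] unfolding J_def by argo
      moreover have "finite J" using fin J(1) finite_subset by blast
      ultimately have "Suc j \<le> card (insert i J)" using i(1) by simp
      also have "\<dots> \<le> card {i\<in>I. l i \<ge> min \<delta> \<delta>'}"
      proof (rule card_mono)
        show "finite {i\<in>I. l i \<ge> min \<delta> \<delta>'}" using fin by simp
        show "insert i J \<subseteq> {i\<in>I. l i \<ge> min \<delta> \<delta>'}"
        proof
          fix a assume "a \<in> insert i J"
          then have "a \<in> I" "\<delta> \<le> l a \<or> \<delta>' \<le> l a" using i by (auto simp: J_def)
          then show "a \<in> {i\<in>I. l i \<ge> min \<delta> \<delta>'}" by (simp add: min_le_iff_disj)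
        qed
      qed
      finally show ?thesis by (rule disjI2)
    qed
  qed
qed

text \<open>With \<open>j = k + 1\<close> the count of large coordinates would exceed
  \<open>card I\<close>, so every coordinate is at least \<open>\<delta>\<close>. The gap lemma then
  applies with \<open>J = I\<close>, where its smallness condition is vacuous.\<close>

lemma isolated_weights_bounded_denominator:
  obtains Q :: nat where
    "\<And>(I :: 'i set) l. \<lbrakk>isolated_weights I l; card I \<le> k\<rbrakk> \<Longrightarrow>
       \<exists>q\<in>{1..Q}. \<forall>i\<in>I. of_nat q * l i \<in> \<int>"
proof -
  obtain \<delta> :: real where \<delta>: "\<delta> > 0"
    "\<And>(I :: 'i set) l. \<lbrakk>isolated_weights I l; card I \<le> k\<rbrakk> \<Longrightarrow>
       (\<forall>i\<in>I. l i \<ge> \<delta>) \<or> Suc k \<le> card {i\<in>I. l i \<ge> \<delta>}"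
    using isolated_weights_many_large[of k "Suc k"] by blast
  obtain Q :: nat and \<delta>' :: real where Q:
    "\<And>(I :: 'i set) l J. \<lbrakk>isolated_weights I l; card I \<le> k; J \<subseteq> I; \<And>i. i \<in> J \<Longrightarrow> l i \<ge> \<delta>;
       \<And>i. i \<in> I - J \<Longrightarrow> l i < \<delta>'\<rbrakk> \<Longrightarrow> J = I \<and> (\<exists>q\<in>{1..Q}. \<forall>i\<in>I. of_nat q * l i \<in> \<int>)"
    by (rule isolated_weights_gap[OF \<delta>(1)]) blast
  have "\<exists>q\<in>{1..Q}. \<forall>i\<in>I. of_nat q * l i \<in> \<int>"
    if "isolated_weights I l" "card I \<le> k" for I :: "'i set" and l
  proof -
    have "card {i\<in>I. l i \<ge> \<delta>} \<le> card I"
      using isolated_weightsD(1)[OF that(1)] by (intro card_mono) auto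
    then have "\<forall>i\<in>I. l i \<ge> \<delta>" using \<delta>(2)[OF that] that(2) by auto
    then show ?thesis using Q[OF that, of I] by auto
  qed
  then show thesis by (rule that)
qed

section \<open>Lattice vectors and support values\<close>

lemma int_lattice_sum:
  assumes "\<And>a. a \<in> S \<Longrightarrow> a \<in> int_lattice"
  shows "(\<Sum>a\<in>S. of_int (n a) *\<^sub>R a) \<in> (int_lattice :: (real ^ 'n) set)"
  using assms unfolding int_lattice_def by (auto intro!: Ints_sum Ints_mult)

lemma int_lattice_inner:
  "a \<in> int_lattice \<Longrightarrow> b \<in> int_lattice \<Longrightarrow> a \<bullet> b \<in> \<int>" for a b :: "real ^ 'n"
  by (auto simp: int_lattice_def inner_vec_def intro!: Ints_sum Ints_mult)

lemma finite_int_lattice_ball: "finite {a \<in> int_lattice :: (real ^ 'n) set. norm a \<le> B}"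
proof (rule finite_subset)
  let ?F = "PiE (UNIV :: 'n set) (\<lambda>_. {-\<lceil>B\<rceil>..\<lceil>B\<rceil>})"
  show "finite ((\<lambda>f. \<chi> i. real_of_int (f i)) ` ?F)"
    by (intro finite_imageI finite_PiE) auto
  show "{a \<in> int_lattice :: (real ^ 'n) set. norm a \<le> B} \<subseteq> (\<lambda>f. \<chi> i. real_of_int (f i)) ` ?F"
  proof
    fix a :: "real ^ 'n"
    assume a: "a \<in> {a \<in> int_lattice. norm a \<le> B}"
    then have eq: "of_int \<lfloor>a $ i\<rfloor> = a $ i" for i
      by (auto simp: int_lattice_def)
    have "\<bar>a $ i\<bar> \<le> B" for i
      using a component_le_norm_cart[of a i] by auto
    then have "\<lfloor>a $ i\<rfloor> \<in> {-\<lceil>B\<rceil>..\<lceil>B\<rceil>}" for i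
      by (smt (verit, best) atLeastAtMost_iff eq ceiling_correct of_int_le_iff of_int_minus)
    moreover have "a = (\<chi> i. of_int \<lfloor>a $ i\<rfloor>)"
      by (simp only: vec_eq_iff vec_lambda_beta eq simp_thms)
    ultimately show "a \<in> (\<lambda>f. \<chi> i. real_of_int (f i)) ` ?F"
      by (intro image_eqI[of _ _ "\<lambda>i. \<lfloor>a $ i\<rfloor>"]) auto
  qed
qed

lemma d_fine_le:
  assumes "compact P" "p \<in> P"
  shows "d_fine P a \<le> a \<bullet> p"
  using d_fine_attained[OF assms(1), of a] assms(2) by force

text \<open>A linear functional attains its minimum over a hull at one of the generators, and two
  integral vectors have an integral inner product.\<close>

lemma d_fine_lattice_polytope_Ints:
  assumes "lattice_polytope P" "P \<noteq> {}" "a \<in> int_lattice"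
  shows "d_fine P a \<in> \<int>"
proof -
  obtain V where V: "finite V" "V \<subseteq> int_lattice" "P = convex hull V"
    using assms(1) by (auto simp: lattice_polytope_def)
  have "V \<noteq> {}" using assms(2) V by auto
  then obtain v where v: "v \<in> V" "\<And>w. w \<in> V \<Longrightarrow> a \<bullet> v \<le> a \<bullet> w"
    using V(1) by (metis arg_min_if_finite(1) arg_min_least)
  have "P \<subseteq> {x. a \<bullet> x \<ge> a \<bullet> v}"
    unfolding V(3) by (intro hull_minimal convex_halfspace_ge) (use v in auto)
  then have "d_fine P a = a \<bullet> v"
    unfolding d_fine_def using v V(3)
    by (intro cInf_eq_minimum) (auto simp: hull_inc)
  then show ?thesis using int_lattice_inner assms(3) v(1) V(2) by auto
qed

text \<open>At a minimizer of the combined functional, each summand is at least its own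
  minimum.\<close>

lemma d_fine_superadditive:
  assumes "compact P" "P \<noteq> {}" "finite S" "\<And>a. a \<in> S \<Longrightarrow> c a \<ge> 0"
  shows "(\<Sum>a\<in>S. c a * d_fine P a) \<le> d_fine P (\<Sum>a\<in>S. c a *\<^sub>R a)"
proof -
  obtain p where p: "p \<in> P" "d_fine P (\<Sum>a\<in>S. c a *\<^sub>R a) = (\<Sum>a\<in>S. c a *\<^sub>R a) \<bullet> p"
    using d_fine_attained[OF assms(1,2)] by blast
  have "(\<Sum>a\<in>S. c a * d_fine P a) \<le> (\<Sum>a\<in>S. c a * (a \<bullet> p))"
    using assms d_fine_le p by (intro sum_mono mult_left_mono) auto
  then show ?thesis by (simp add: p inner_sum_left)
qed

section \<open>The Fine core\<close>

text \<open>Every real direction is nearly proportional to an integral one.\<close>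

lemma fine_adjoint_subset_interior:
  fixes P :: "(real ^ 'n) set"
  assumes P: "compact P" "convex P" "interior P \<noteq> {}" and s: "s > 0"
  shows "fine_adjoint P s \<subseteq> interior P"
proof
  fix x assume x: "x \<in> fine_adjoint P s"
  show "x \<in> interior P"
  proof (rule ccontr)
    assume "x \<notin> interior P"
    then obtain u b where u: "u \<noteq> 0" "u \<bullet> x \<le> b" "\<And>y. y \<in> interior P \<Longrightarrow> u \<bullet> y \<ge> b"
      using separating_hyperplane_sets[of "{x}" "interior P"] P by (auto simp: convex_interior)
    have "closure (interior P) \<subseteq> {y. u \<bullet> y \<ge> b}"
      using u(3) by (intro closure_minimal closed_halfspace_ge) auto
    then have uP: "u \<bullet> p \<ge> u \<bullet> x" if "p \<in> P" for p
      using convex_closure_interior[OF P(2,3)] closure_subset[of P] that u(2) by force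
    obtain i where i: "u $ i \<noteq> 0" using u(1) by (auto simp: vec_eq_iff)
    have "bounded ((\<lambda>p. x - p) ` P)"
      by (intro compact_imp_bounded compact_continuous_image continuous_intros P)
    then obtain R where R: "R > 0" "\<And>p. p \<in> P \<Longrightarrow> norm (x - p) \<le> R"
      unfolding bounded_pos by blast
    \<comment> \<open>The coordinates of \<open>a - q u\<close> are below \<open>1 / N\<close>, so
      pairing this vector with one of length at most \<open>R\<close> gives at most
      \<open>C / N < s\<close>. As \<open>u\<close> does not separate in favour of \<open>x\<close>,
      this contradicts a slack of at least \<open>s\<close>. The bound by
      \<open>\<bar>u $ i\<bar>\<close> ensures that the rounded vector \<open>a\<close> is
      nonzero.\<close>
    define C where "C = real CARD('n) * R"
    have C: "C > 0" using R by (simp add: C_def)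
    obtain N :: nat where N: "N > 0" "1 / N < min \<bar>u $ i\<bar> (s / C)"
      using i s C by (metis divide_pos_pos min_less_iff_conj nat_approx_posE
        zero_less_Suc zero_less_abs_iff)
    obtain q p where q: "0 < q"
      and p: "\<And>j. j \<in> UNIV \<Longrightarrow> \<bar>of_int q * u $ j - of_int (p j)\<bar> < 1 / N"
      by (rule Dirichlet_approx_finite_set[OF N(1) finite order_refl, of "UNIV :: 'n set" "\<lambda>j. u $ j"])
        blast
    define a :: "real ^ 'n" where "a = (\<chi> j. of_int (p j))"
    have "\<bar>u $ i\<bar> \<le> \<bar>of_int q * u $ i\<bar>"
      using q by (simp add: abs_mult mult_le_cancel_right1)
    then have "p i \<noteq> 0" using p[of i] N(2) by force
    then have "a \<in> int_lattice - {0}"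
      by (auto simp: a_def int_lattice_def vec_eq_iff)
    moreover obtain y where y: "y \<in> P" "d_fine P a = a \<bullet> y"
      using d_fine_attained[OF P(1), of a] P(3) interior_subset[of P] by blast
    ultimately have "s \<le> a \<bullet> (x - y)"
      using x by (force simp: fine_adjoint_def inner_diff_right)
    also have "\<dots> = of_int q * (u \<bullet> (x - y)) + (a - of_int q *\<^sub>R u) \<bullet> (x - y)"
      by (simp add: inner_diff_left)
    also have "\<dots> \<le> (a - of_int q *\<^sub>R u) \<bullet> (x - y)"
      using uP[OF y(1)] q by (simp add: inner_diff_right mult_nonneg_nonpos)
    also have "\<dots> \<le> norm (a - of_int q *\<^sub>R u) * norm (x - y)"
      by (rule norm_cauchy_schwarz)
    also have "\<dots> \<le> (real CARD('n) * (1 / N)) * R"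
    proof (intro mult_mono)
      have "norm (a - of_int q *\<^sub>R u) \<le> (\<Sum>j\<in>UNIV. \<bar>(a - of_int q *\<^sub>R u) $ j\<bar>)"
        by (rule norm_le_l1_cart)
      also have "\<dots> \<le> (\<Sum>j\<in>(UNIV :: 'n set). 1 / N)"
        using p by (intro sum_mono) (auto simp: a_def abs_minus_commute intro: less_imp_le)
      finally show "norm (a - of_int q *\<^sub>R u) \<le> real CARD('n) * (1 / N)" by simp
    qed (use R y in auto)
    also have "\<dots> = C * (1 / N)" by (simp add: C_def)
    also have "\<dots> < C * (s / C)" using N C by (intro mult_strict_left_mono) auto
    also have "\<dots> = s" using C by simp
    finally show False by simp
  qed
qed

text \<open>Compactness: \<open>s\<close> is maximized over pairs of a parameter and a point of its
  Fine adjoint.\<close>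

lemma fine_adjoint_Sup_attained:
  fixes P :: "(real ^ 'n) set"
  assumes P: "compact P" "convex P" "interior P \<noteq> {}"
  defines "T \<equiv> {s. s > 0 \<and> fine_adjoint P s \<noteq> {}}"
  shows "Sup T \<in> T"
proof -
  obtain s0 where s0: "s0 \<in> T" using fine_adjoint_witness[OF P(1,3)] by (auto simp: T_def)
  have bdd: "bdd_above T" unfolding T_def by (rule fine_adjoint_bdd_above)
  \<comment> \<open>The lower bound \<open>s0 > 0\<close> replaces the open condition
    \<open>s > 0\<close>, so that \<open>K\<close> is closed; it also places the points in
    \<open>P\<close>, which makes \<open>K\<close> bounded.\<close>
  define K where "K = {(x, s). s0 \<le> s \<and> x \<in> fine_adjoint P s}"
  have s0': "s0 > 0" using s0 by (simp add: T_def)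
  have KT: "snd ` K \<subseteq> T" using s0' by (auto simp: K_def T_def)
  have "K \<subseteq> P \<times> {s0..Sup T}"
  proof clarify
    fix x s assume "(x, s) \<in> K"
    moreover from this have "s \<in> T" using KT by force
    ultimately show "x \<in> P \<and> s \<in> {s0..Sup T}"
      using fine_adjoint_subset_interior[OF P, of s] interior_subset[of P] cSup_upper[OF _ bdd]
      by (auto simp: K_def T_def)
  qed
  moreover have "closed K"
  proof -
    have "K = {z. s0 \<le> snd z} \<inter> (\<Inter>a\<in>int_lattice - {0}. {z. d_fine P a + snd z \<le> a \<bullet> fst z})"
      by (auto simp: K_def fine_adjoint_def)
    moreover have "closed \<dots>"
      by (intro closed_Int closed_INT ballI closed_Collect_le continuous_intros)
    ultimately show ?thesis by simp
  qed
  ultimately have "compact K"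
    using P(1) by (metis compact_Times compact_Icc compact_Int_closed inf.absorb2)
  moreover have "K \<noteq> {}" using s0 by (auto simp: K_def T_def)
  ultimately obtain z where z: "z \<in> K" "\<And>y. y \<in> K \<Longrightarrow> snd y \<le> snd z"
    using continuous_attains_sup[of K snd] continuous_on_snd[OF continuous_on_id] by blast
  have zT: "snd z \<in> T" using z KT by auto
  have "s \<le> snd z" if "s \<in> T" for s
  proof (cases "s0 \<le> s")
    case True
    from \<open>s \<in> T\<close> obtain x where "x \<in> fine_adjoint P s" by (auto simp: T_def)
    with True have "(x, s) \<in> K" by (simp add: K_def)
    then show ?thesis using z(2) by force
  next
    case False
    then show ?thesis using z(1) by (auto simp: K_def)
  qed
  then have "Sup T = snd z" using zT by (intro cSup_eq_maximum) auto
  then show ?thesis using zT by simp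
qed

section \<open>Active normals at an optimal point\<close>

definition fine_active :: "(real ^ 'n) set \<Rightarrow> real \<Rightarrow> real ^ 'n \<Rightarrow> (real ^ 'n) set" where
  "fine_active P s x = {a \<in> int_lattice - {0}. a \<bullet> x = d_fine P a + s}"

text \<open>Moving from \<open>x\<close> by \<open>r\<close> against \<open>a\<close> stays in
  \<open>P\<close> and lowers the functional by \<open>r * norm a\<close>. Slack thus grows with the
  norm, so only finitely many lattice normals can be nearly active.\<close>

lemma fine_gap_ge_norm:
  assumes "compact P" "cball x r \<subseteq> P" "r \<ge> 0"
  shows "a \<bullet> x - d_fine P a \<ge> r * norm a"
proof (cases "a = 0")
  case True
  moreover have "x \<in> P" using assms(2,3) by auto
  ultimately show ?thesis using d_fine_le[OF assms(1), of x a] by simp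
next
  case False
  let ?y = "x - (r / norm a) *\<^sub>R a"
  have "?y \<in> P" using assms False by (intro subsetD[OF assms(2)]) (simp add: dist_norm)
  then have "d_fine P a \<le> a \<bullet> ?y" by (rule d_fine_le[OF assms(1)])
  also have "\<dots> = a \<bullet> x - r * norm a"
    using False by (simp add: inner_diff_right dot_square_norm power2_eq_square)
  finally show ?thesis by simp
qed

text \<open>By separation, all active constraints could otherwise be relaxed by moving in one direction.\<close>

lemma zero_in_hull_fine_active:
  fixes P :: "(real ^ 'n) set"
  assumes P: "compact P" and x: "x \<in> fine_adjoint P s" "x \<in> interior P" and s: "s > 0"
    and max: "\<And>s'. s' > s \<Longrightarrow> fine_adjoint P s' = {}"
  shows "0 \<in> convex hull (fine_active P s x)"
proof (rule ccontr)
  define A where "A = fine_active P s x"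
  assume 0: "0 \<notin> convex hull (fine_active P s x)"
  obtain r where r: "r > 0" "cball x r \<subseteq> P"
    using x(2) by (auto simp: mem_interior_cball)
  have gap: "a \<bullet> x - d_fine P a \<ge> r * norm a" for a
    using fine_gap_ge_norm[OF P r(2)] r(1) by simp
  \<comment> \<open>Outside \<open>F\<close> the slack at \<open>x\<close> exceeds
    \<open>2 * s + 2\<close>. A move shorter than \<open>r / 2\<close> uses up at most half of it,
    leaving more than \<open>s + 1\<close>, enough for \<open>s + \<sigma>\<close> with
    \<open>\<sigma> < 1\<close>.\<close>
  define F where "F = {a \<in> int_lattice. norm a \<le> (2 * s + 2) / r} - {0 :: real ^ 'n}"
  have F: "finite F" unfolding F_def using finite_int_lattice_ball by blast
  have "A \<subseteq> F"
  proof
    fix a assume "a \<in> A"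
    then have "a \<in> int_lattice - {0}" "r * norm a \<le> s"
      using gap[of a] by (auto simp: A_def fine_active_def)
    then show "a \<in> F" using r s by (auto simp: F_def field_simps)
  qed
  then have "finite A" using F finite_subset by blast
  then have "closed (convex hull A)"
    by (simp add: compact_imp_closed finite_imp_compact_convex_hull)
  \<comment> \<open>The direction \<open>v\<close> pairs positively with every active normal, so a
    small step along it makes those constraints strict, while the inactive ones in \<open>F\<close>
    stay strict by continuity.\<close>
  then obtain v b where v: "b > 0" "\<And>a. a \<in> convex hull A \<Longrightarrow> v \<bullet> a > b"
    using separating_hyperplane_closed_0[of "convex hull A"] 0 unfolding A_def by auto
  have "\<forall>\<^sub>F t in at_right 0. a \<bullet> (x + t *\<^sub>R v) > d_fine P a + s" if a: "a \<in> F" for a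
  proof (cases "a \<in> A")
    case True
    then have "a \<bullet> v > 0" using v hull_inc[of a A convex] by (force simp: inner_commute)
    moreover have "a \<bullet> x = d_fine P a + s" using True by (simp add: A_def fine_active_def)
    ultimately show ?thesis
      by (intro eventually_at_right_less[THEN eventually_mono]) (simp add: inner_add_right)
  next
    case False
    then have "a \<bullet> x > d_fine P a + s"
      using a x(1) by (force simp: A_def F_def fine_active_def fine_adjoint_def)
    moreover have "((\<lambda>t. a \<bullet> (x + t *\<^sub>R v)) \<longlongrightarrow> a \<bullet> (x + 0 *\<^sub>R v)) (at_right 0)"
      by (intro tendsto_intros)
    ultimately show ?thesis by (intro order_tendstoD) auto
  qed
  then have "\<forall>\<^sub>F t in at_right 0. \<forall>a\<in>F. a \<bullet> (x + t *\<^sub>R v) > d_fine P a + s"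
    using F by (simp add: eventually_ball_finite)
  moreover have "\<forall>\<^sub>F t in at_right 0. norm (t *\<^sub>R v) < r / 2"
  proof -
    have "((\<lambda>t. norm (t *\<^sub>R v)) \<longlongrightarrow> norm (0 *\<^sub>R v)) (at_right 0)"
      by (intro tendsto_intros)
    then show ?thesis using r by (intro order_tendstoD) auto
  qed
  ultimately obtain t where t: "\<And>a. a \<in> F \<Longrightarrow> a \<bullet> (x + t *\<^sub>R v) > d_fine P a + s"
    "norm (t *\<^sub>R v) < r / 2"
    using eventually_happens'[OF trivial_limit_at_right_real eventually_conj] by blast
  \<comment> \<open>At \<open>y\<close> the finitely many constraints from \<open>F\<close> are
    strict, which leaves room to raise \<open>s\<close> by some \<open>\<sigma> > 0\<close>, against
    maximality.\<close>
  define y where "y = x + t *\<^sub>R v"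
  have "\<forall>\<^sub>F \<sigma> in at_right 0. a \<bullet> y > d_fine P a + (s + \<sigma>)" if "a \<in> F" for a
  proof -
    have "((\<lambda>\<sigma>. d_fine P a + (s + \<sigma>)) \<longlongrightarrow> d_fine P a + (s + 0)) (at_right 0)"
      by (intro tendsto_intros)
    then show ?thesis using t(1)[OF that] by (intro order_tendstoD) (auto simp: y_def)
  qed
  then have "\<forall>\<^sub>F \<sigma> in at_right 0. \<forall>a\<in>F. a \<bullet> y > d_fine P a + (s + \<sigma>)"
    using F by (simp add: eventually_ball_finite)
  moreover have "\<forall>\<^sub>F \<sigma> in at_right 0. 0 < \<sigma> \<and> \<sigma> < (1::real)"
    by (intro eventually_conj eventually_at_right_less) (simp add: eventually_at_right_field, use zero_less_one in blast)
  ultimately obtain \<sigma> where \<sigma>: "\<And>a. a \<in> F \<Longrightarrow> a \<bullet> y > d_fine P a + (s + \<sigma>)" "0 < \<sigma>" "\<sigma> < 1"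
    using eventually_happens'[OF trivial_limit_at_right_real eventually_conj] by blast
  have "y \<in> fine_adjoint P (s + \<sigma>)"
    unfolding fine_adjoint_def
  proof (intro CollectI ballI)
    fix a :: "real ^ 'n" assume a: "a \<in> int_lattice - {0}"
    show "d_fine P a + (s + \<sigma>) \<le> a \<bullet> y"
    proof (cases "a \<in> F")
      case True
      then show ?thesis using \<sigma>(1) less_imp_le by blast
    next
      case False
      then have "2 * s + 2 < r * norm a" using a r by (auto simp: F_def field_simps)
      moreover have "\<bar>a \<bullet> (t *\<^sub>R v)\<bar> \<le> norm a * norm (t *\<^sub>R v)"
        by (rule Cauchy_Schwarz_ineq2)
      moreover have "norm a * norm (t *\<^sub>R v) \<le> norm a * (r / 2)"
        using t(2) by (intro mult_left_mono) auto
      moreover have "norm a * (r / 2) = r * norm a / 2" by simp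
      ultimately show ?thesis
        using gap[of a] \<sigma>(3) s unfolding y_def inner_add_right by argo
    qed
  qed
  then show False using max[of "s + \<sigma>"] \<sigma>(2) by auto
qed

text \<open>Take a finite subset of least cardinality whose hull contains \<open>x\<close>.
  Caratheodory's theorem and minimality make it affinely independent, and a vertex of weight 0 could
  be dropped.\<close>

lemma minimal_affine_independent_hull:
  fixes A :: "'a::euclidean_space set"
  assumes "x \<in> convex hull A"
  obtains S l where "finite S" "S \<subseteq> A" "\<not> affine_dependent S" "card S \<le> DIM('a) + 1"
    "\<And>a. a \<in> S \<Longrightarrow> l a > 0" "sum l S = 1" "(\<Sum>a\<in>S. l a *\<^sub>R a) = x"
proof -
  let ?p = "\<lambda>S. finite S \<and> S \<subseteq> A \<and> x \<in> convex hull S"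
  obtain S0 where S0: "?p S0" using assms unfolding caratheodory_aff_dim[of A] by blast
  define S where "S = arg_min card ?p"
  have S: "?p S" unfolding S_def by (rule arg_min_natI[where P = ?p, OF S0])
  have min: "card S \<le> card S'" if "?p S'" for S'
    unfolding S_def by (rule arg_min_nat_le[where P = ?p, OF that])
  obtain S' where S': "finite S'" "S' \<subseteq> S" "card S' \<le> aff_dim S + 1" "x \<in> convex hull S'"
    using S unfolding caratheodory_aff_dim[of S] by blast
  have "S' \<subseteq> A" using S S'(2) by blast
  then have "card S \<le> card S'" using S' by (intro min conjI)
  then have "card S \<le> aff_dim S + 1" using S'(3) by linarith
  moreover have "aff_dim S \<le> int (card S) - 1" using S by (intro aff_dim_le_card) blast
  ultimately have "aff_dim S = int (card S) - 1" by linarith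
  then have ind: "\<not> affine_dependent S"
    using S affine_independent_iff_card by blast
  have card: "card S \<le> DIM('a) + 1"
    using \<open>card S \<le> aff_dim S + 1\<close> aff_dim_le_DIM[of S] by linarith
  obtain l where l: "\<And>a. a \<in> S \<Longrightarrow> l a \<ge> 0" "sum l S = 1" "(\<Sum>a\<in>S. l a *\<^sub>R a) = x"
    using S convex_hull_finite[of S] by blast
  have "l a > 0" if a: "a \<in> S" for a
  proof (rule ccontr)
    assume "\<not> l a > 0"
    then have "l a = 0" using l(1)[OF a] by simp
    then have "sum l (S - {a}) = 1" "(\<Sum>a\<in>S - {a}. l a *\<^sub>R a) = x"
      using l(2,3) S a by (simp_all add: sum_diff1)
    then have "x \<in> convex hull (S - {a})"
      using S l(1) convex_hull_finite[of "S - {a}"] by blast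
    then have "card S \<le> card (S - {a})" using S by (intro min) blast
    then show False using a S by (meson card_Diff1_less linorder_not_le)
  qed
  then show thesis using that S ind card l by blast
qed

text \<open>
  A lattice point \<open>p \<noteq> 0\<close> in the relative interior of the simplex spanned by active normals is a
  combination of them with coefficient sum below 1, so its constraint would be violated.
\<close>

lemma fine_active_isolated_weights:
  fixes P :: "(real ^ 'n) set"
  assumes P: "compact P" "P \<noteq> {}" and x: "x \<in> fine_adjoint P s" and s: "s > 0"
    and S: "finite S" "S \<subseteq> fine_active P s x" "\<not> affine_dependent S"
    and l: "\<And>a. a \<in> S \<Longrightarrow> l a > 0" "sum l S = 1" "(\<Sum>a\<in>S. l a *\<^sub>R a) = 0"
  shows "isolated_weights S l"
  unfolding isolated_weights_def
proof (intro conjI allI impI; (elim conjE)?)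
  fix m :: int and n :: "real ^ 'n \<Rightarrow> int"
  define \<mu> where "\<mu> = (\<lambda>a. of_int m * l a - of_int (n a))"
  assume "\<forall>a\<in>S. of_int m * l a - of_int (n a) > 0"
    and "(\<Sum>a\<in>S. of_int m * l a - of_int (n a)) = 1"
  then have \<mu>: "\<And>a. a \<in> S \<Longrightarrow> \<mu> a > 0" "sum \<mu> S = 1" by (auto simp: \<mu>_def)
  define p where "p = (\<Sum>a\<in>S. \<mu> a *\<^sub>R a)"
  have "p = of_int m *\<^sub>R (\<Sum>a\<in>S. l a *\<^sub>R a) + (\<Sum>a\<in>S. of_int (- n a) *\<^sub>R a)"
    by (simp add: p_def \<mu>_def scaleR_diff_left sum_subtractf scaleR_sum_right sum_negf)
  then have p_int: "p \<in> int_lattice"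
    using int_lattice_sum[of S "\<lambda>a. - n a"] S(2) l(3) by (auto simp: fine_active_def)
  have "p = 0"
  proof (rule ccontr)
    assume "p \<noteq> 0"
    have "S \<noteq> {}" using l(2) by auto
    \<comment> \<open>Subtracting \<open>c\<close> times the relation \<open>\<Sum> l a = 0\<close>
      leaves \<open>p\<close> unchanged but lowers the coefficient sum to \<open>1 - c\<close>. The
      coefficients stay nonnegative because \<open>l a \<le> 1\<close> and \<open>c\<close> is the
      least \<open>\<mu> a\<close>.\<close>
    define c where "c = Min (\<mu> ` S)"
    have c: "c > 0" "\<And>a. a \<in> S \<Longrightarrow> c \<le> \<mu> a"
      using S(1) \<open>S \<noteq> {}\<close> \<mu>(1) by (auto simp: c_def)
    define \<nu> where "\<nu> = (\<lambda>a. \<mu> a - c * l a)"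
    have "l a \<le> 1" if "a \<in> S" for a
      using member_le_sum[of a S l] that S(1) l by (auto intro: less_imp_le)
    then have "c * l a \<le> c" if "a \<in> S" for a
      using c(1) that by (intro mult_left_le) auto
    then have \<nu>: "\<nu> a \<ge> 0" if "a \<in> S" for a
      using c(2)[OF that] that by (force simp: \<nu>_def)
    have "(\<Sum>a\<in>S. \<nu> a *\<^sub>R a) = p - c *\<^sub>R (\<Sum>a\<in>S. l a *\<^sub>R a)"
      by (simp add: p_def \<nu>_def scaleR_diff_left sum_subtractf scaleR_sum_right)
    then have p\<nu>: "p = (\<Sum>a\<in>S. \<nu> a *\<^sub>R a)" using l(3) by simp
    have "sum \<nu> S = sum \<mu> S - c * sum l S"
      by (simp add: \<nu>_def sum_subtractf sum_distrib_left)
    then have sum\<nu>: "sum \<nu> S = 1 - c" using \<mu>(2) l(2) by simp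
    have "p \<bullet> x = (\<Sum>a\<in>S. \<nu> a * (a \<bullet> x))" by (simp add: p\<nu> inner_sum_left)
    also have "\<dots> = (\<Sum>a\<in>S. \<nu> a * (d_fine P a + s))"
      using S(2) by (intro sum.cong) (auto simp: fine_active_def)
    also have "\<dots> = (\<Sum>a\<in>S. \<nu> a * d_fine P a) + (1 - c) * s"
      by (simp add: sum\<nu>[symmetric] distrib_left sum.distrib sum_distrib_right)
    also have "\<dots> \<le> d_fine P p + (1 - c) * s"
      unfolding p\<nu> using d_fine_superadditive[OF P S(1) \<nu>] by simp
    also have "\<dots> < d_fine P p + s" using c(1) s by simp
    also have "\<dots> \<le> p \<bullet> x"
      using x p_int \<open>p \<noteq> 0\<close> by (auto simp: fine_adjoint_def)
    finally show False by simp
  qed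
  \<comment> \<open>Now \<open>\<mu>\<close> and \<open>l\<close> are both barycentric coordinates
    of the origin, so affine independence makes them equal.\<close>
  define w where "w = (\<lambda>a. \<mu> a - l a)"
  have "sum w S = 0" "(\<Sum>a\<in>S. w a *\<^sub>R a) = 0"
    using \<mu>(2) l(2,3) \<open>p = 0\<close>
    by (simp_all add: w_def p_def sum_subtractf scaleR_diff_left)
  then have "\<forall>a\<in>S. w a = 0"
    using S(3) affine_dependent_explicit_finite[OF S(1)] by blast
  then show "\<forall>a\<in>S. of_int m * l a - of_int (n a) = l a"
    by (simp add: w_def \<mu>_def)
qed (use S l in auto)

section \<open>Finiteness from bounded denominators\<close>

theorem theorem5p4:
  fixes \<epsilon> :: real
  assumes "\<epsilon> > 0"
  shows "finite {fine_codegree P | P :: (real ^ 'n) set.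
           lattice_polytope P \<and> aff_dim P = int CARD('n) \<and> fine_codegree P \<ge> \<epsilon>}"
proof -
  obtain Q :: nat where Q:
    "\<And>(S :: (real ^ 'n) set) l. \<lbrakk>isolated_weights S l; card S \<le> CARD('n) + 1\<rbrakk> \<Longrightarrow>
       \<exists>q\<in>{1..Q}. \<forall>a\<in>S. of_nat q * l a \<in> \<int>"
    by (rule isolated_weights_bounded_denominator) blast
  \<comment> \<open>The candidates are the inverses of \<open>s = k / q\<close> with
    \<open>1 \<le> q \<le> Q\<close>; the range of \<open>k\<close> comes from
    \<open>s \<le> 1 / \<epsilon>\<close>.\<close>
  define B where "B = (\<lambda>(q::nat, k::int). inverse (of_int k / of_nat q :: real)) `
    ({1..Q} \<times> {0..\<lceil>real Q / \<epsilon>\<rceil>})"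
  have "fine_codegree P \<in> B"
    if P: "lattice_polytope P" "aff_dim P = int CARD('n)" "fine_codegree P \<ge> \<epsilon>"
    for P :: "(real ^ 'n) set"
  proof -
    obtain V where V: "finite V" "P = convex hull V"
      using P(1) by (auto simp: lattice_polytope_def)
    have cc: "compact P" "convex P"
      using V by (auto simp: finite_imp_compact_convex_hull)
    have ne: "P \<noteq> {}" using P(2) by auto
    have int: "interior P \<noteq> {}"
      using interior_rel_interior[of P] rel_interior_eq_empty[OF cc(2)] P(2) ne by simp
    define s where "s = Sup {s. s > 0 \<and> fine_adjoint P s \<noteq> {}}"
    have "s \<in> {s. s > 0 \<and> fine_adjoint P s \<noteq> {}}"
      unfolding s_def by (rule fine_adjoint_Sup_attained[OF cc int])
    then obtain x where s: "s > 0" and x: "x \<in> fine_adjoint P s" by blast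
    have max: "fine_adjoint P s' = {}" if "s' > s" for s'
      using cSup_upper[OF _ fine_adjoint_bdd_above, of s' P] that s
      by (force simp: s_def[symmetric])
    have "x \<in> interior P"
      using fine_adjoint_subset_interior[OF cc int s] x by blast
    then have "0 \<in> convex hull (fine_active P s x)"
      by (intro zero_in_hull_fine_active cc x s max)
    then obtain S l where S: "finite S" "S \<subseteq> fine_active P s x" "\<not> affine_dependent S"
        "card S \<le> CARD('n) + 1"
      and l: "\<And>a. a \<in> S \<Longrightarrow> l a > 0" "sum l S = 1" "(\<Sum>a\<in>S. l a *\<^sub>R a) = 0"
      by (rule minimal_affine_independent_hull) auto
    have "isolated_weights S l"
      by (rule fine_active_isolated_weights[OF cc(1) ne x s S(1-3) l])
    then obtain q where q: "q \<in> {1..Q}" "\<And>a. a \<in> S \<Longrightarrow> of_nat q * l a \<in> \<int>"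
      using Q S(4) by blast
    \<comment> \<open>Pairing the relation \<open>\<Sum> l a = 0\<close> with \<open>x\<close>
      eliminates \<open>x\<close> and expresses \<open>s\<close> through support values, which are
      integers.\<close>
    have "(\<Sum>a\<in>S. l a * d_fine P a) + s * sum l S = (\<Sum>a\<in>S. l a * (d_fine P a + s))"
      by (simp add: distrib_left sum.distrib sum_distrib_left mult.commute)
    also have "\<dots> = (\<Sum>a\<in>S. l a * (a \<bullet> x))"
      using S(2) by (intro sum.cong) (auto simp: fine_active_def)
    also have "\<dots> = (\<Sum>a\<in>S. l a *\<^sub>R a) \<bullet> x" by (simp add: inner_sum_left)
    finally have "s = - (\<Sum>a\<in>S. l a * d_fine P a)" using l(2,3) by simp
    then have "of_nat q * s = - (\<Sum>a\<in>S. (of_nat q * l a) * d_fine P a)"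
      by (simp add: sum_distrib_left mult.assoc)
    moreover have "(\<Sum>a\<in>S. (of_nat q * l a) * d_fine P a) \<in> \<int>"
    proof (intro Ints_sum, rule Ints_mult)
      fix a assume "a \<in> S"
      then show "of_nat q * l a \<in> \<int>" "d_fine P a \<in> \<int>"
        using q S(2) d_fine_lattice_polytope_Ints[OF P(1) ne] by (auto simp: fine_active_def)
    qed
    ultimately have "of_nat q * s \<in> \<int>" by simp
    then obtain k where k: "of_nat q * s = of_int k" by (elim Ints_cases)
    have mu: "fine_codegree P = inverse s" by (simp add: fine_codegree_def s_def)
    have "s \<le> 1 / \<epsilon>"
      using P(3) s assms unfolding mu by (simp add: field_simps)
    then have "of_nat q * s \<le> real Q * (1 / \<epsilon>)"
      using q s by (intro mult_mono) auto
    then have "real_of_int k \<le> real Q / \<epsilon>" using k by simp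
    then have "k \<le> \<lceil>real Q / \<epsilon>\<rceil>" by linarith
    moreover have "of_nat q * s \<ge> 0" using s by simp
    then have "k \<ge> 0" using k by simp
    moreover have "s = of_int k / of_nat q" using k q by (simp add: field_simps)
    ultimately show ?thesis
      unfolding mu B_def using q by (intro image_eqI[of _ _ "(q, k)"]) auto
  qed
  then have "{fine_codegree P | P :: (real ^ 'n) set.
      lattice_polytope P \<and> aff_dim P = int CARD('n) \<and> fine_codegree P \<ge> \<epsilon>} \<subseteq> B" by blast
  moreover have "finite B" by (simp add: B_def)
  ultimately show ?thesis by (rule finite_subset)
qed

end
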